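(* Let $(\lambda,v)$ be a simple eigenpair of the problem $A(v)v=\lambda v$ with $\frac12 v^Tv=1$, and let $w_1,\dots,w_m\ge0$ be given weights. Then $$\kappa_{\mathrm{sym}}^{(2)}(v)=\kappa(v)\quad\text{and}\quad \kappa_{\mathrm{sym}}^{(F)}(v)=\frac{1}{\sqrt2}\,\kappa(v).$$ (Here $\kappa(v)$ may be taken with respect to either the spectral or the Frobenius norm.)
   Context: Setting. Let $n,m$ be positive integers, and let $A:\mathbb{R}^n\to\mathbb{R}^{n\times n}$ be of the form $A(v)=\sum_{i=1}^m f_i(v)A_i$, where each $A_i\in\mathbb{R}^{n\times n}$ is symmetric and each $f_i:\mathbb{R}^n\to\mathbb{R}$ is scaling invariant, i.e. $f_i(\alpha x)=f_i(x)$ for all $x\in\mathbb{R}^n$ and $\alpha\in\mathbb{R}\setminus\{0\}$, and continuously differentiable on $\mathbb{R}^n\setminus\{0\}$. Hence $A(v)$ is symmetric, $A(\alpha x)=A(x)$ for $\alpha\ne0$, and $A$ is continuously differentiable on $\mathbb{R}^n\setminus\{0\}$. An eigenpair is $(\lambda,v)\in\mathbb{R}\times(\mathbb{R}^n\setminus\{0\})$ with $A(v)v=\lambda v$. The Jacobian is $J(v):=\frac{\partial}{\partial v}\left(A(v)v\right)\in\mathbb{R}^{n\times n}$. (By scaling invariance $J(v)v=A(v)v$, so $v$ is an eigenvector of $J(v)$ with eigenvalue $\lambda$.) The eigenpair $(\lambda,v)$ is called simple if $\lambda$ is a simple (algebraic multiplicity one) eigenvalue of the matrix $J(v)$ with eigenvector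 $v$. Perturbations. Fix matrices $E_1,\dots,E_m\in\mathbb{R}^{n\times n}$. For a simple eigenpair $(\lambda,v)$ with $\frac12v^Tv=1$, the implicit function theorem gives an open set $\mathcal U\subset\mathbb{R}$ containing $0$ and unique differentiable functions $\lambda(\varepsilon),v(\varepsilon)$ on $\mathcal U$ with $\lambda(0)=\lambda$, $v(0)=v$ and, for all $\varepsilon\in\mathcal U$, $$\Big(A(v(\varepsilon))+\varepsilon\sum_{i=1}^m f_i(v(\varepsilon))E_i\Big)v(\varepsilon)=\lambda(\varepsilon)v(\varepsilon),\qquad \tfrac12 v(\varepsilon)^Tv(\varepsilon)=1 .$$ Write $v'=v'(0)$ (it depends on $E_1,\dots,E_m$). Definitions. Given weights $w_i\ge0$, $$\kappa(v)=\sup\left\{\frac{\|v'\|}{\|v\|}:\ E_i\in\mathbb{R}^{n\times n},\ \|E_i\|\le w_i,\ i=1,\dots,m\right\},$$ where the matrix norm on the $E_i$ is either the spectral norm or the Frobenius norm, and $$\kappa_{\mathrm{sym}}^{( * )}(v)=\sup\left\{\frac{\|v'\|}{\|v\|}:\ E_i\in\mathbb{R}^{n\times n},\ \|E_i\|_*\le w_i,\ E_i=E_i^T,\ i=1,\dots,m\right\},$$ where $*=2$ denotes the spectral norm and $*=F$ the Frobenius norm. For vectors, $\|\cdot\|$ is the Euclidean norm. *)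

theory Defs
  imports "HOL-Analysis.Analysis" "HOL-Computational_Algebra.Polynomial"
begin

definition scaling_invariant :: "(real^'n \<Rightarrow> real) \<Rightarrow> bool" where
  "scaling_invariant f \<longleftrightarrow> (\<forall>x. \<forall>\<alpha>. \<alpha> \<noteq> 0 \<longrightarrow> f (\<alpha> *\<^sub>R x) = f x)"

definition continuously_differentiable_on :: "(real^'n \<Rightarrow> real) \<Rightarrow> (real^'n) set \<Rightarrow> bool" where
  "continuously_differentiable_on f S \<longleftrightarrow>
     (\<exists>f' :: real^'n \<Rightarrow> ((real^'n) \<Rightarrow>\<^sub>L real).
        (\<forall>x\<in>S. (f has_derivative blinfun_apply (f' x)) (at x)) \<and> continuous_on S f')"

definition mat_comb :: "('m::finite \<Rightarrow> real^'n \<Rightarrow> real) \<Rightarrow> ('m \<Rightarrow> real^'n^'n) \<Rightarrow> real^'n \<Rightarrow> real^'n^'n" where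
  "mat_comb f A v = (\<Sum>i\<in>UNIV. f i v *\<^sub>R A i)"

definition eigenpair :: "(real^'n \<Rightarrow> real^'n^'n) \<Rightarrow> real \<Rightarrow> real^'n \<Rightarrow> bool" where
  "eigenpair M l v \<longleftrightarrow> v \<noteq> 0 \<and> M v *v v = l *\<^sub>R v"

definition charpoly :: "real^'n^'n \<Rightarrow> real poly" where
  "charpoly B = det (mat [:0, 1:] - map_matrix (\<lambda>c. [:c:]) B)"

definition jac :: "(real^'n \<Rightarrow> real^'n^'n) \<Rightarrow> real^'n \<Rightarrow> real^'n^'n" where
  "jac M v = jacobian (\<lambda>x. M x *v x) (at v)"

definition simple_eigenpair :: "(real^'n \<Rightarrow> real^'n^'n) \<Rightarrow> real \<Rightarrow> real^'n \<Rightarrow> bool" where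
  "simple_eigenpair M l v \<longleftrightarrow>
     eigenpair M l v \<and> jac M v *v v = l *\<^sub>R v \<and> order l (charpoly (jac M v)) = 1"

text \<open>\<open>eigvec_deriv f A E l v d\<close> says that \<open>d\<close> is the derivative at \<open>0\<close> of the normalised
  eigenvector of the perturbed problem along the branch through \<open>(l, v)\<close>.
  For a simple eigenpair and given \<open>E\<close>, the implicit function theorem yields exactly one
  such \<open>d\<close>.  It is formulated as a relation, so that no choice of the branch or of its
  domain \<open>U\<close> is needed.\<close>

definition eigvec_deriv ::
    "('m::finite \<Rightarrow> real^'n \<Rightarrow> real) \<Rightarrow> ('m \<Rightarrow> real^'n^'n) \<Rightarrow> ('m \<Rightarrow> real^'n^'n) \<Rightarrow>
      real \<Rightarrow> real^'n \<Rightarrow> real^'n \<Rightarrow> bool" where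
  "eigvec_deriv f A E l v d \<longleftrightarrow>
     (\<exists>(U :: real set) (L :: real \<Rightarrow> real) (V :: real \<Rightarrow> real^'n).
        open U \<and> 0 \<in> U \<and> L differentiable_on U \<and> V differentiable_on U \<and>
        L 0 = l \<and> V 0 = v \<and>
        (\<forall>\<epsilon>\<in>U. (mat_comb f A (V \<epsilon>) + \<epsilon> *\<^sub>R (\<Sum>i\<in>UNIV. f i (V \<epsilon>) *\<^sub>R E i)) *v V \<epsilon> = L \<epsilon> *\<^sub>R V \<epsilon> \<and>
               1/2 * (V \<epsilon> \<bullet> V \<epsilon>) = 1) \<and>
        (V has_vector_derivative d) (at 0))"

definition spectral_norm :: "real^'n^'n \<Rightarrow> real" where
  "spectral_norm B = onorm (\<lambda>x. B *v x)"

definition frobenius_norm :: "real^'n^'n \<Rightarrow> real" where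
  "frobenius_norm B = sqrt (\<Sum>i\<in>UNIV. \<Sum>j\<in>UNIV. (B $ i $ j)\<^sup>2)"

text \<open>The first argument \<open>N\<close> of the condition numbers is the matrix norm measuring the \<open>E i\<close>.
  The suprema are taken in \<^typ>\<open>ereal\<close>, so they are meaningful without proving boundedness first.\<close>

definition kappa ::
    "(real^'n^'n \<Rightarrow> real) \<Rightarrow> ('m::finite \<Rightarrow> real) \<Rightarrow> ('m \<Rightarrow> real^'n \<Rightarrow> real) \<Rightarrow> ('m \<Rightarrow> real^'n^'n) \<Rightarrow>
      real \<Rightarrow> real^'n \<Rightarrow> ereal" where
  "kappa N w f A l v =
     Sup {ereal (norm d / norm v) | d E. (\<forall>i. N (E i) \<le> w i) \<and> eigvec_deriv f A E l v d}"

definition kappa_sym ::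
    "(real^'n^'n \<Rightarrow> real) \<Rightarrow> ('m::finite \<Rightarrow> real) \<Rightarrow> ('m \<Rightarrow> real^'n \<Rightarrow> real) \<Rightarrow> ('m \<Rightarrow> real^'n^'n) \<Rightarrow>
      real \<Rightarrow> real^'n \<Rightarrow> ereal" where
  "kappa_sym N w f A l v =
     Sup {ereal (norm d / norm v) | d E.
       (\<forall>i. N (E i) \<le> w i \<and> E i = transpose (E i)) \<and> eigvec_deriv f A E l v d}"

end

theory Submission
  imports Defs
begin

text \<open>
  Differentiating the perturbed eigenvalue equation gives
  \<open>J d + y = l d + l' v\<close> and \<open>v \<bullet> d = 0\<close>, where \<open>J\<close> is the Jacobian and
  \<open>y = (\<Sum>i. f i v *\<^sub>R (E i *v v))\<close>.  For a simple eigenvalue this system is uniquely solvable,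
  so \<open>d = X y\<close> with \<open>X\<close> linear and \<open>X v = 0\<close>; conversely the inverse function theorem
  provides the branch for every \<open>E\<close>.  It remains to find the possible values of \<open>y\<close>.  With
  \<open>r = (\<Sum>i. \<bar>f i v\<bar> * w i)\<close> they fill the ball of radius \<open>r * norm v\<close>, attained by rank-one
  matrices in general and by scaled Householder reflections for symmetric matrices in the spectral
  norm.  For symmetric matrices in the Frobenius norm, the components orthogonal to \<open>v\<close>, which are
  all that \<open>X\<close> sees, fill the ball of radius \<open>r * norm v / sqrt 2\<close>.
\<close>

section \<open>Multiple roots of the characteristic polynomial\<close>

text \<open>The determinant is an integer polynomial in the entries, so ring homomorphisms commute
  with it. It is applied to evaluation of polynomials at a point and to the embedding of constants
  into polynomials.\<close>

lemma det_map_matrix: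
  fixes h :: "'a::comm_ring_1 \<Rightarrow> 'b::comm_ring_1" and B :: "'a^'n^'n"
  assumes add: "\<And>x y. h (x + y) = h x + h y" and mult: "\<And>x y. h (x * y) = h x * h y"
    and one: "h 1 = 1"
  shows "det (map_matrix h B) = h (det B)"
proof -
  have zero: "h 0 = 0" using add[of 0 0] by simp
  have neg: "h (- x) = - h x" for x
    using add[of x "- x"] zero by (simp add: eq_neg_iff_add_eq_0 add.commute)
  have sum: "h (sum g S) = (\<Sum>x\<in>S. h (g x))" for g :: "('n \<Rightarrow> 'n) \<Rightarrow> 'a" and S
    by (induction S rule: infinite_finite_induct) (auto simp: zero add)
  have prod: "h (prod g S) = (\<Prod>x\<in>S. h (g x))" for g :: "'n \<Rightarrow> 'a" and S
    by (induction S rule: infinite_finite_induct) (auto simp: one mult)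
  have "h (of_int (sign p)) = of_int (sign p)" for p :: "'n \<Rightarrow> 'n"
    by (cases p rule: sign_cases) (auto simp: one neg)
  then show ?thesis
    by (simp add: det_def sum mult prod)
qed

lemma poly_charpoly: "poly (charpoly B) t = det (mat t - B)"
proof -
  have "poly (charpoly B) t =
      det (map_matrix (\<lambda>p. poly p t) (mat [:0, 1:] - map_matrix (\<lambda>c. [:c:]) B))"
    unfolding charpoly_def by (rule det_map_matrix[symmetric]) auto
  also have "map_matrix (\<lambda>p. poly p t) (mat [:0, 1:] - map_matrix (\<lambda>c. [:c:]) B) = mat t - B"
    by (simp add: vec_eq_iff mat_def)
  finally show ?thesis .
qed

lemma mat_vector_mul: "mat t *v x = t *s x"
  by (simp add: vec_eq_iff mat_def matrix_vector_mult_def if_distrib[of "\<lambda>z. z * _"] cong: if_cong)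

text \<open>Divisibility by a power bounds the order from below only for a nonzero polynomial.
  Numbers above the operator norm cannot be eigenvalues, so they are not roots.\<close>

lemma charpoly_nonzero: "charpoly (B :: real^'n^'n) \<noteq> 0"
proof
  assume "charpoly B = 0"
  moreover define t where "t = onorm (\<lambda>x. B *v x) + 1"
  ultimately have "det (mat t - B) = 0"
    using poly_charpoly[of B t] by simp
  then have "\<not> (\<exists>C. C ** (mat t - B) = mat 1)"
    using invertible_det_nz invertible_left_inverse by blast
  then obtain x where x: "(mat t - B) *v x = 0" "x \<noteq> 0"
    unfolding matrix_left_invertible_ker by blast
  have "B *v x = t *\<^sub>R x"
    using x(1) by (simp add: matrix_vector_mult_diff_rdistrib mat_vector_mul scalar_mult_eq_scaleR)
  moreover have "norm (B *v x) \<le> onorm (\<lambda>x. B *v x) * norm x"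
    by (simp add: matrix_vector_mul_bounded_linear onorm)
  moreover have "0 \<le> onorm (\<lambda>x. B *v x)"
    by (simp add: matrix_vector_mul_bounded_linear onorm_pos_le)
  ultimately show False using x(2) by (simp add: t_def)
qed

text \<open>Since \<open>u $ a = 0\<close>, the entries in rows and columns \<open>a\<close>,
  \<open>b\<close> form a triangular block with diagonal \<open>v $ a\<close>, \<open>u $ b\<close>.
  The kernel of the transpose is solved in this order: first coordinate \<open>a\<close>, then
  \<open>b\<close>, then the rest.\<close>

lemma det_row_replacement_nonzero:
  fixes v u :: "real^'n"
  assumes "v $ a \<noteq> 0" "u $ a = 0" "u $ b \<noteq> 0"
  shows "det (\<chi> i. if i = a then v else if i = b then u else axis i 1) \<noteq> 0"
    (is "det ?S \<noteq> 0")
proof -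
  have ab: "a \<noteq> b" using assms by auto
  have "x = 0" if "transpose ?S *v x = 0" for x :: "real^'n"
  proof -
    have col: "(\<Sum>i\<in>UNIV. (if i = a then v $ j else if i = b then u $ j else axis i 1 $ j) * x $ i) = 0"
      for j
      using that by (simp add: vec_eq_iff matrix_vector_mult_def transpose_def
          if_distrib[of "\<lambda>z. z $ _"] cong: if_cong)
    have expand: "v $ j * x $ a + u $ j * x $ b + (if j = a \<or> j = b then 0 else x $ j) = 0" for j
    proof -
      have "(\<Sum>i\<in>UNIV. (if i = a then v $ j else if i = b then u $ j else axis i 1 $ j) * x $ i)
        = (\<Sum>i\<in>UNIV. (if i = a then v $ j * x $ a else 0) + (if i = b then u $ j * x $ b else 0)
            + (if i = j then if j = a \<or> j = b then 0 else x $ j else 0))"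
        using ab by (intro sum.cong) (auto simp: axis_def)
      with col[of j] show ?thesis by (simp add: sum.distrib)
    qed
    have xa: "x $ a = 0" using expand[of a] assms by simp
    have xb: "x $ b = 0" using expand[of b] assms xa by simp
    show ?thesis
      unfolding vec_eq_iff
    proof
      fix j show "x $ j = 0 $ j"
        using expand[of j] xa xb by (auto split: if_splits)
    qed
  qed
  then have "invertible (transpose ?S)"
    unfolding invertible_left_inverse matrix_left_invertible_ker by blast
  then show ?thesis by (simp add: invertible_det_nz del: if_image_distrib)
qed

text \<open>A Jordan chain or a second eigenvector gives two independent vectors from each of which
  a factor \<open>t - l\<close> of the determinant can be extracted.\<close>

lemma order_charpoly_ge_2:
  fixes B :: "real^'n^'n"
  assumes v: "B *v v = l *\<^sub>R v" "v \<noteq> 0"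
    and u: "B *v u = l *\<^sub>R u + \<mu> *\<^sub>R v" "\<And>c. u \<noteq> c *\<^sub>R v"
  shows "order l (charpoly B) \<ge> 2"
proof -
  obtain a where a: "v $ a \<noteq> 0" using v(2) by (auto simp: vec_eq_iff)
  \<comment> \<open>Removing a multiple of the eigenvector \<open>v\<close> clears coordinate
    \<open>a\<close> without changing the chain relation, as the triangular shape of
    \<open>S\<close> demands.\<close>
  define w where "w = u - (u $ a / v $ a) *\<^sub>R v"
  have wa: "w $ a = 0" using a by (simp add: w_def)
  have "w \<noteq> 0" using u(2) by (simp add: w_def)
  then obtain b where b: "w $ b \<noteq> 0" by (auto simp: vec_eq_iff)
  have ab: "a \<noteq> b" using wa b by auto
  have w: "B *v w = l *\<^sub>R w + \<mu> *\<^sub>R v"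
    by (simp add: w_def matrix_vector_mult_diff_distrib matrix_vector_mult_scaleR u v algebra_simps)
  define S where "S = (\<chi> i. if i = a then v else if i = b then w else axis i 1)"
  have S: "det S \<noteq> 0"
    unfolding S_def by (rule det_row_replacement_nonzero[OF a wa b])
  define q where "q = [:- l, 1:]"
  define C where "C = mat [:0, 1:] - map_matrix (\<lambda>c. [:c:]) B"
  define c where "c x = (\<chi> j. [:x $ j:])" for x :: "real^'n"
  \<comment> \<open>\<open>det Q\<close> is \<open>det S\<close> times the characteristic
    polynomial, while the rows of \<open>Q\<close> are \<open>C\<close> applied to the rows of
    \<open>S\<close>; the factors \<open>q\<close> become visible in rows \<open>a\<close> and
    \<open>b\<close>.\<close>
  define Q where "Q = map_matrix (\<lambda>c. [:c:]) S ** transpose C"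
  define R where "R i = (if i = a then c v else if i = b then c w else Q $ i)" for i
  define R' where "R' i = (if i = b then q *s c w - [:\<mu>:] *s c v else R i)" for i
  have Cc: "C *v c x = [:0, 1:] *s c x - c (B *v x)" for x
  proof -
    have "map_matrix (\<lambda>c. [:c:]) B *v c x = c (B *v x)"
      by (simp add: vec_eq_iff c_def matrix_vector_mult_def mult_monom monom_sum flip: monom_0)
    then show ?thesis
      by (simp add: C_def matrix_vector_mult_diff_rdistrib mat_vector_mul)
  qed
  have Qrow: "Q $ i = C *v c (S $ i)" for i
    by (simp add: Q_def vec_eq_iff matrix_matrix_mult_def matrix_vector_mult_def transpose_def c_def mult.commute)
  have Qa: "Q $ a = q *s c v"
    unfolding Qrow Cc by (simp add: S_def v vec_eq_iff c_def q_def)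
  have Qb: "Q $ b = q *s c w - [:\<mu>:] *s c v"
    unfolding Qrow Cc using ab by (simp add: S_def w vec_eq_iff c_def q_def)
  have "Q = (\<chi> i. (if i = a then q else 1) *s R' i)"
    unfolding vec_eq_iff[of Q] using ab by (simp add: R'_def R_def Qa Qb)
  then have "det Q = q * det (vec_lambda R')"
    by (simp add: det_rows_mul)
  \<comment> \<open>Once \<open>q\<close> is extracted from row \<open>a\<close>, that row is
    \<open>c v\<close>, so adding \<open>[:\<mu>:]\<close> times it to row \<open>b\<close> cancels
    the remainder and leaves a second multiple of \<open>q\<close>.\<close>
  also have "det (vec_lambda R') =
      det (\<chi> k. if k = b then row b (vec_lambda R') + [:\<mu>:] *s row a (vec_lambda R') else row k (vec_lambda R'))"
    using ab by (intro det_row_operation[symmetric]) auto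
  also have "(\<chi> k. if k = b then row b (vec_lambda R') + [:\<mu>:] *s row a (vec_lambda R') else row k (vec_lambda R'))
      = (\<chi> i. (if i = b then q else 1) *s R i)"
    using ab by (auto simp: vec_eq_iff row_def R'_def R_def)
  also have "det \<dots> = q * det (vec_lambda R)"
    by (simp add: det_rows_mul)
  finally have "det Q = q ^ 2 * det (vec_lambda R)"
    by (simp add: power2_eq_square mult.assoc)
  moreover have "det Q = smult (det S) (charpoly B)"
    unfolding Q_def det_mul det_transpose
    by (subst det_map_matrix) (auto simp: C_def charpoly_def)
  ultimately have "q ^ 2 dvd charpoly B"
    using S by (metis dvd_smult_iff dvd_triv_left)
  then show ?thesis
    using charpoly_nonzero[of B] unfolding q_def by (simp add: order_divides)
qed

section \<open>Eigenvector branches\<close>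

text \<open>In finite dimension, continuity of the derivative in operator norm can be checked on
  basis vectors. This provides the bundled form that the inverse function theorem asks for.\<close>

lemma blinfun_derivative:
  fixes g :: "'a::euclidean_space \<Rightarrow> 'b::real_normed_vector"
  assumes der: "\<And>x. x \<in> S \<Longrightarrow> (g has_derivative D x) (at x)"
    and cont: "\<And>j. j \<in> Basis \<Longrightarrow> continuous_on S (\<lambda>x. D x j)"
  obtains g' :: "'a \<Rightarrow> 'a \<Rightarrow>\<^sub>L 'b"
  where "\<And>x. x \<in> S \<Longrightarrow> blinfun_apply (g' x) = D x" "continuous_on S g'"
proof
  show app: "blinfun_apply (Blinfun (D x)) = D x" if "x \<in> S" for x
    using has_derivative_bounded_linear[OF der[OF that]] by (rule bounded_linear_Blinfun_apply)
  show "continuous_on S (\<lambda>x. Blinfun (D x))"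
  proof (rule continuous_on_blinfun_componentwise)
    fix j :: 'a assume "j \<in> Basis"
    then show "continuous_on S (\<lambda>x. blinfun_apply (Blinfun (D x)) j)"
      using cont continuous_on_cong[of S S "\<lambda>x. blinfun_apply (Blinfun (D x)) j" "\<lambda>x. D x j"] app
      by simp
  qed
qed

lemma mat_comb_mult_vec: "mat_comb f A x *v y = (\<Sum>i\<in>UNIV. f i x *\<^sub>R (A i *v y))"
  by (simp add: mat_comb_def scaleR_matrix_vector_assoc
      sum_comp_morphism[of "\<lambda>M. M *v y", unfolded o_def, symmetric] matrix_vector_mult_add_rdistrib)

lemma mat_comb_C1:
  fixes f :: "'m::finite \<Rightarrow> real^'n \<Rightarrow> real"
  assumes "\<And>i. continuously_differentiable_on (f i) S"
  obtains F' :: "real^'n \<Rightarrow> (real^'n) \<Rightarrow>\<^sub>L (real^'n)"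
  where "\<And>x. x \<in> S \<Longrightarrow> ((\<lambda>x. mat_comb f A x *v x) has_derivative blinfun_apply (F' x)) (at x)"
    "continuous_on S F'"
proof -
  obtain f' where f': "\<And>i x. x \<in> S \<Longrightarrow> (f i has_derivative blinfun_apply (f' i x)) (at x)"
    and cont': "\<And>i. continuous_on S (f' i)"
    using assms unfolding continuously_differentiable_on_def by metis
  have contf: "continuous_on S (f i)" for i
    by (intro continuous_at_imp_continuous_on ballI has_derivative_continuous[OF f'])
  define D where "D x h = (\<Sum>i\<in>UNIV. f i x *\<^sub>R (A i *v h) + f' i x h *\<^sub>R (A i *v x))" for x h
  have der: "((\<lambda>x. mat_comb f A x *v x) has_derivative D x) (at x)" if "x \<in> S" for x
    unfolding mat_comb_mult_vec D_def[abs_def]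
    by (intro has_derivative_sum has_derivative_scaleR f' that
        bounded_linear.has_derivative[OF matrix_vector_mul_bounded_linear] has_derivative_ident)
  have "continuous_on S (\<lambda>x. D x j)" for j
    unfolding D_def
    by (intro continuous_intros contf cont' bounded_linear.continuous_on[OF matrix_vector_mul_bounded_linear])
  then show ?thesis
    using blinfun_derivative[of S "\<lambda>x. mat_comb f A x *v x" D] der that by (metis (no_types, lifting))
qed

text \<open>An implicit function argument by way of the inverse function theorem: the parameter is
  adjoined as a coordinate of \<open>G\<close>, and \<open>nondeg\<close> makes the derivative of
  \<open>G\<close> at \<open>(0, v, l)\<close> injective, hence invertible in finite
  dimension.\<close>

lemma eigenvector_branch:
  fixes F K :: "'a::euclidean_space \<Rightarrow> 'a" and F' K' :: "'a \<Rightarrow> 'a \<Rightarrow>\<^sub>L 'a"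
  assumes S: "open S" "v \<in> S"
    and F: "\<And>x. x \<in> S \<Longrightarrow> (F has_derivative blinfun_apply (F' x)) (at x)" "continuous_on S F'"
    and K: "\<And>x. x \<in> S \<Longrightarrow> (K has_derivative blinfun_apply (K' x)) (at x)" "continuous_on S K'"
    and eig: "F v = l *\<^sub>R v"
    and nondeg: "\<And>h m. F' v h = l *\<^sub>R h + m *\<^sub>R v \<Longrightarrow> v \<bullet> h = 0 \<Longrightarrow> h = 0 \<and> m = 0"
  obtains U :: "real set" and L :: "real \<Rightarrow> real" and V :: "real \<Rightarrow> 'a"
  where "open U" "0 \<in> U" "L differentiable_on U" "V differentiable_on U" "L 0 = l" "V 0 = v"
    "\<And>\<epsilon>. \<epsilon> \<in> U \<Longrightarrow> F (V \<epsilon>) + \<epsilon> *\<^sub>R K (V \<epsilon>) = L \<epsilon> *\<^sub>R V \<epsilon>"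
    "\<And>\<epsilon>. \<epsilon> \<in> U \<Longrightarrow> V \<epsilon> \<bullet> V \<epsilon> = v \<bullet> v"
proof -
  define W where "W = (UNIV :: real set) \<times> S \<times> (UNIV :: real set)"
  define G where "G p = (fst p, F (fst (snd p)) + fst p *\<^sub>R K (fst (snd p)) - snd (snd p) *\<^sub>R fst (snd p),
      fst (snd p) \<bullet> fst (snd p))" for p :: "real \<times> 'a \<times> real"
  define D where "D p q = (fst q, F' (fst (snd p)) (fst (snd q)) +
      (fst p *\<^sub>R K' (fst (snd p)) (fst (snd q)) + fst q *\<^sub>R K (fst (snd p)))
      - (snd (snd p) *\<^sub>R fst (snd q) + snd (snd q) *\<^sub>R fst (snd p)),
      fst (snd p) \<bullet> fst (snd q) + fst (snd q) \<bullet> fst (snd p))" for p q :: "real \<times> 'a \<times> real"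
  have W: "open W" unfolding W_def by (intro open_Times open_UNIV S)
  have fst_W: "fst (snd p) \<in> S" if "p \<in> W" for p using that by (auto simp: W_def)
  have der: "(G has_derivative D p) (at p)" if "p \<in> W" for p
  proof -
    have fs: "((\<lambda>p. fst (snd p)) has_derivative (\<lambda>q. fst (snd q))) (at p)"
      by (intro derivative_intros)
    have 1: "((\<lambda>p. F (fst (snd p))) has_derivative (\<lambda>q. F' (fst (snd p)) (fst (snd q)))) (at p)"
      by (rule has_derivative_compose[OF fs F(1)[OF fst_W[OF that]]])
    have 2: "((\<lambda>p. K (fst (snd p))) has_derivative (\<lambda>q. K' (fst (snd p)) (fst (snd q)))) (at p)"
      by (rule has_derivative_compose[OF fs K(1)[OF fst_W[OF that]]])
    show ?thesis
      unfolding G_def[abs_def] D_def[abs_def]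
      by (rule has_derivative_Pair has_derivative_add has_derivative_diff has_derivative_scaleR
          has_derivative_inner 1 2 has_derivative_fst has_derivative_snd has_derivative_ident)+
  qed
  have contK: "continuous_on S K"
    by (intro continuous_at_imp_continuous_on ballI has_derivative_continuous[OF K(1)])
  have sub: "(\<lambda>p. fst (snd p)) ` W \<subseteq> S" using fst_W by blast
  have cfs: "continuous_on W (\<lambda>p. fst (snd p))" by (intro continuous_intros)
  have "continuous_on W (\<lambda>p. D p q)" for q
    unfolding D_def
    by (intro continuous_intros continuous_on_compose2[OF F(2) cfs sub]
        continuous_on_compose2[OF K(2) cfs sub] continuous_on_compose2[OF contK cfs sub])
  with der obtain G' where G': "\<And>p. p \<in> W \<Longrightarrow> blinfun_apply (G' p) = D p" "continuous_on W G'"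
    using blinfun_derivative[of W G D] by metis
  have p0: "(0, v, l) \<in> W" using S by (simp add: W_def)
  let ?T = "blinfun_apply (G' (0, v, l))"
  have lin: "linear ?T" by (simp add: blinfun.bounded_linear_right bounded_linear.linear)
  \<comment> \<open>The first component forces \<open>e = 0\<close>; together with the parameter
    value 0 this removes both terms coming from \<open>K\<close>, and what is left is exactly
    \<open>nondeg\<close>.\<close>
  have "inj ?T"
    unfolding linear_injective_0[OF lin]
  proof (intro allI impI)
    fix q assume "?T q = 0"
    then have "D (0, v, l) q = 0" by (simp add: G'(1)[OF p0])
    moreover obtain e h m where q: "q = (e, h, m)" by (cases q)
    ultimately have "e = 0" "F' v h = l *\<^sub>R h + m *\<^sub>R v" "v \<bullet> h = 0"
      by (auto simp: D_def zero_prod_def inner_commute)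
    with nondeg[of h m] q show "q = 0" by (simp add: zero_prod_def)
  qed
  then obtain T where T: "linear T" "T \<circ> ?T = id"
    using linear_injective_left_inverse[OF lin] by blast
  have inv: "Blinfun T o\<^sub>L G' (0, v, l) = id_blinfun"
    using T(1) pointfree_idE[OF T(2)]
    by (intro blinfun_eqI) (simp add: bounded_linear_Blinfun_apply linear_linear)
  have derG: "(G has_derivative blinfun_apply (G' p)) (at p)" if "p \<in> W" for p
    using der[OF that] G'(1)[OF that] by simp
  obtain W' Y g g' where "open W'" and W': "W' \<subseteq> W" "(0, v, l) \<in> W'"
    and Y: "open Y" "G (0, v, l) \<in> Y" and hom: "homeomorphism W' Y G g"
    and g': "\<And>y. y \<in> Y \<Longrightarrow> (g has_derivative (g' y)) (at y)"
  proof (rule inverse_function_theorem[OF W derG G'(2) p0 inv])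
    fix W' Y g g'
    assume "open W'" "W' \<subseteq> W" "(0, v, l) \<in> W'" "open Y" "G (0, v, l) \<in> Y"
      "homeomorphism W' Y G g" "\<And>y. y \<in> Y \<Longrightarrow> (g has_derivative g' y) (at y)"
    then show thesis by (rule that)
  qed
  \<comment> \<open>This line in the target encodes the eigenvalue equation and the normalisation
    for each parameter; its image under the local inverse \<open>g\<close> is the branch.\<close>
  define \<iota> where "\<iota> \<epsilon> = (\<epsilon>, 0 :: 'a, v \<bullet> v)" for \<epsilon> :: real
  define U where "U = \<iota> -` Y"
  have cont: "continuous_on UNIV \<iota>" unfolding \<iota>_def by (intro continuous_intros)
  have G0: "G (0, v, l) = \<iota> 0" by (simp add: G_def \<iota>_def eig)
  have diff: "(\<lambda>\<epsilon>. g (\<iota> \<epsilon>)) differentiable (at \<epsilon>)" if "\<epsilon> \<in> U" for \<epsilon>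
  proof -
    have "(\<iota> has_derivative (\<lambda>e. (e, 0, 0))) (at \<epsilon>)"
      unfolding \<iota>_def by (intro derivative_intros)
    from has_derivative_compose[OF this g'] that show ?thesis
      by (auto simp: differentiable_def U_def)
  qed
  have Gg: "G (g (\<iota> \<epsilon>)) = \<iota> \<epsilon>" if "\<epsilon> \<in> U" for \<epsilon>
    using that hom by (simp add: U_def homeomorphism_def)
  have g0: "g (\<iota> 0) = (0, v, l)"
    using hom W'(2) by (metis G0 homeomorphism_def)
  have diff_U: "(\<lambda>\<epsilon>. b (g (\<iota> \<epsilon>))) differentiable_on U" if "bounded_linear b"
    for b :: "real \<times> 'a \<times> real \<Rightarrow> 'c::real_normed_vector"
    unfolding differentiable_on_def
  proof
    fix \<epsilon> assume "\<epsilon> \<in> U"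
    then obtain D where "((\<lambda>\<epsilon>. g (\<iota> \<epsilon>)) has_derivative D) (at \<epsilon>)"
      using diff unfolding differentiable_def by blast
    from bounded_linear.has_derivative[OF that this]
    show "(\<lambda>\<epsilon>. b (g (\<iota> \<epsilon>))) differentiable at \<epsilon> within U"
      by (meson differentiableI differentiable_at_withinI)
  qed
  show ?thesis
  proof (rule that[of U "\<lambda>\<epsilon>. snd (snd (g (\<iota> \<epsilon>)))" "\<lambda>\<epsilon>. fst (snd (g (\<iota> \<epsilon>)))"])
    show "open U" unfolding U_def by (rule open_vimage[OF Y(1) cont])
    show "0 \<in> U" using Y(2) by (simp add: U_def G0)
    show "(\<lambda>\<epsilon>. snd (snd (g (\<iota> \<epsilon>)))) differentiable_on U"
      by (rule diff_U) (intro bounded_linear_intros)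
    show "(\<lambda>\<epsilon>. fst (snd (g (\<iota> \<epsilon>)))) differentiable_on U"
      by (rule diff_U) (intro bounded_linear_intros)
    show "snd (snd (g (\<iota> 0))) = l" "fst (snd (g (\<iota> 0))) = v" by (simp_all add: g0)
    fix \<epsilon> assume "\<epsilon> \<in> U"
    then show "F (fst (snd (g (\<iota> \<epsilon>)))) + \<epsilon> *\<^sub>R K (fst (snd (g (\<iota> \<epsilon>)))) =
        snd (snd (g (\<iota> \<epsilon>))) *\<^sub>R fst (snd (g (\<iota> \<epsilon>)))"
      and "fst (snd (g (\<iota> \<epsilon>))) \<bullet> fst (snd (g (\<iota> \<epsilon>))) = v \<bullet> v"
      using Gg[of \<epsilon>] by (auto simp: G_def \<iota>_def)
  qed
qed

text \<open>Both identities hold on a neighbourhood of 0 and are differentiated there. The number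
  \<open>m\<close> is the derivative of \<open>L\<close> at 0, and \<open>K'\<close> drops out
  because its factor is the parameter value 0.\<close>

lemma eigenvector_branch_derivative:
  fixes F K :: "'a::euclidean_space \<Rightarrow> 'a" and V :: "real \<Rightarrow> 'a"
  assumes U: "open U" "0 \<in> U" and L: "L differentiable_on U"
    and V: "(V has_vector_derivative d) (at 0)" "V 0 = v" "L 0 = l"
    and F: "(F has_derivative F') (at v)" and K: "(K has_derivative K') (at v)"
    and eq: "\<And>\<epsilon>. \<epsilon> \<in> U \<Longrightarrow> F (V \<epsilon>) + \<epsilon> *\<^sub>R K (V \<epsilon>) = L \<epsilon> *\<^sub>R V \<epsilon>"
    and nrm: "\<And>\<epsilon>. \<epsilon> \<in> U \<Longrightarrow> V \<epsilon> \<bullet> V \<epsilon> = v \<bullet> v"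
  obtains m where "F' d + K v = l *\<^sub>R d + m *\<^sub>R v" "v \<bullet> d = 0"
proof -
  have V': "(V has_derivative (\<lambda>h. h *\<^sub>R d)) (at 0)"
    using V(1) by (simp add: has_vector_derivative_def)
  have "L differentiable (at 0)"
    using L U by (simp add: differentiable_on_eq_differentiable_at)
  then obtain m where L': "(L has_derivative (\<lambda>h. m * h)) (at 0)"
    unfolding real_differentiable_def has_field_derivative_def by blast
  have FV: "((\<lambda>\<epsilon>. F (V \<epsilon>)) has_derivative (\<lambda>h. F' (h *\<^sub>R d))) (at 0)"
    using has_derivative_compose[OF V'] F V(2) by simp
  have KV: "((\<lambda>\<epsilon>. K (V \<epsilon>)) has_derivative (\<lambda>h. K' (h *\<^sub>R d))) (at 0)"
    using has_derivative_compose[OF V'] K V(2) by simp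
  have "((\<lambda>\<epsilon>. F (V \<epsilon>) + \<epsilon> *\<^sub>R K (V \<epsilon>) - L \<epsilon> *\<^sub>R V \<epsilon>) has_derivative
      (\<lambda>h. F' (h *\<^sub>R d) + (0 *\<^sub>R K' (h *\<^sub>R d) + h *\<^sub>R K (V 0)) - (L 0 *\<^sub>R (h *\<^sub>R d) + (m * h) *\<^sub>R V 0))) (at 0)"
    by (intro derivative_intros FV KV V' L')
  moreover have "((\<lambda>\<epsilon>. F (V \<epsilon>) + \<epsilon> *\<^sub>R K (V \<epsilon>) - L \<epsilon> *\<^sub>R V \<epsilon>) has_derivative (\<lambda>h. 0)) (at 0)"
    by (rule has_derivative_transform_within_open[OF has_derivative_const[of 0] U]) (simp add: eq)
  ultimately have 1: "(\<lambda>h. F' (h *\<^sub>R d) + (0 *\<^sub>R K' (h *\<^sub>R d) + h *\<^sub>R K (V 0)) - (L 0 *\<^sub>R (h *\<^sub>R d) + (m * h) *\<^sub>R V 0)) = (\<lambda>h. 0)"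
    by (rule has_derivative_unique)
  have "((\<lambda>\<epsilon>. V \<epsilon> \<bullet> V \<epsilon>) has_derivative (\<lambda>h. V 0 \<bullet> (h *\<^sub>R d) + (h *\<^sub>R d) \<bullet> V 0)) (at 0)"
    by (intro derivative_intros V')
  moreover have "((\<lambda>\<epsilon>. V \<epsilon> \<bullet> V \<epsilon>) has_derivative (\<lambda>h. 0)) (at 0)"
    by (rule has_derivative_transform_within_open[OF has_derivative_const[of "v \<bullet> v"] U]) (simp add: nrm)
  ultimately have 2: "(\<lambda>h. V 0 \<bullet> (h *\<^sub>R d) + (h *\<^sub>R d) \<bullet> V 0) = (\<lambda>h. 0)"
    by (rule has_derivative_unique)
  show ?thesis
    using fun_cong[OF 1, of 1] fun_cong[OF 2, of 1] V
    by (intro that[of m]) (simp_all add: algebra_simps inner_commute)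
qed

section \<open>Matrices of small norm mapping one vector to another\<close>

text \<open>The rank-one matrix \<open>a b^T\<close>. The inner product on matrices is the Frobenius
  one, so pairing with it evaluates a matrix as a bilinear form.\<close>

definition outer :: "real^'n \<Rightarrow> real^'n \<Rightarrow> real^'n^'n" where
  "outer a b = (\<chi> i j. a $ i * b $ j)"

lemma outer_mult_vec: "outer a b *v x = (b \<bullet> x) *\<^sub>R a"
  by (simp add: outer_def vec_eq_iff matrix_vector_mult_def inner_vec_def sum_distrib_left mult_ac)

lemma inner_outer: "B \<bullet> outer a b = a \<bullet> (B *v b)"
  by (simp add: outer_def matrix_vector_mult_def inner_vec_def sum_distrib_left mult_ac)

lemma norm_outer: "norm (outer a b) = norm a * norm b"
proof -
  have "(norm (outer a b))\<^sup>2 = (norm a * norm b)\<^sup>2"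
    by (simp add: dot_square_norm[symmetric] power_mult_distrib inner_outer outer_mult_vec)
  then show ?thesis by (simp add: power2_eq_iff_nonneg)
qed

lemma frobenius_norm_eq: "frobenius_norm = norm"
  by (auto simp: fun_eq_iff frobenius_norm_def norm_eq_sqrt_inner inner_vec_def power2_eq_square)

text \<open>Cauchy-Schwarz for the pairing of \<open>B\<close> with the rank-one matrix
  \<open>outer (B *v x) x\<close>.\<close>

lemma norm_mult_vec_le_frobenius: "norm (B *v x) \<le> norm B * norm (x :: real^'n)" for B :: "real^'n^'n"
proof (cases "B *v x = 0")
  case False
  have "(norm (B *v x))\<^sup>2 = B \<bullet> outer (B *v x) x"
    by (simp add: inner_outer dot_square_norm)
  also have "\<dots> \<le> norm B * (norm (B *v x) * norm x)"
    by (metis norm_cauchy_schwarz norm_outer)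
  finally show ?thesis using False by (simp add: power2_eq_square)
qed simp

lemma norm_mult_vec_le_spectral: "norm (B *v x) \<le> spectral_norm B * norm x"
  by (simp add: spectral_norm_def matrix_vector_mul_bounded_linear onorm)

lemma spectral_le_frobenius: "spectral_norm B \<le> frobenius_norm B"
  unfolding spectral_norm_def frobenius_norm_eq
  by (rule onorm_le) (rule norm_mult_vec_le_frobenius)

lemma spectral_norm_scaleR: "spectral_norm (k *\<^sub>R B) = \<bar>k\<bar> * spectral_norm B"
  unfolding spectral_norm_def
  using onorm_scaleR[OF matrix_vector_mul_bounded_linear, of k B]
  by (simp add: scaleR_matrix_vector_assoc)

lemma transpose_scaleR: "transpose (k *\<^sub>R B) = k *\<^sub>R transpose (B :: real^'n^'m)"
  by (simp add: transpose_def vec_eq_iff)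

text \<open>A multiple of the reflection exchanging the directions of \<open>v\<close> and \<open>y\<close>.  If these
  coincide then \<open>h = 0\<close>, and division by zero turns the reflection into the identity.\<close>

lemma symmetric_spectral_interpolation:
  fixes v y :: "real^'n"
  assumes "v \<noteq> 0"
  obtains B where "transpose B = B" "B *v v = y" "spectral_norm B \<le> norm y / norm v"
proof -
  define s where "s = norm y / norm v"
  define h where "h = s *\<^sub>R v - y"
  define H where "H = mat 1 - (2 / (h \<bullet> h)) *\<^sub>R outer h h"
  have H: "H *v x = x - (2 * (h \<bullet> x) / (h \<bullet> h)) *\<^sub>R h" for x
    by (simp add: H_def matrix_vector_mult_diff_rdistrib scaleR_matrix_vector_assoc[symmetric] outer_mult_vec)
  have s: "(s *\<^sub>R v) \<bullet> (s *\<^sub>R v) = y \<bullet> y"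
    using assms by (simp only: dot_square_norm) (simp add: s_def)
  have isometry: "norm (H *v x) = norm x" for x
  proof -
    have "(H *v x) \<bullet> (H *v x) = x \<bullet> x"
      by (cases "h = 0") (simp_all add: H inner_diff_left inner_diff_right inner_commute field_simps)
    then show ?thesis by (simp add: norm_eq)
  qed
  have "H *v (s *\<^sub>R v) = y"
  proof (cases "h = 0")
    case False
    \<comment> \<open>Equal lengths of \<open>s *\<^sub>R v\<close> and \<open>y\<close> give this
      identity; hence the reflection subtracts exactly \<open>h\<close> from
      \<open>s *\<^sub>R v\<close>.\<close>
    have "h \<bullet> h = 2 * (h \<bullet> (s *\<^sub>R v))"
      using s by (simp add: h_def inner_diff_left inner_diff_right inner_commute)
    with False have "2 * (h \<bullet> (s *\<^sub>R v)) / (h \<bullet> h) = 1"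
      by (metis divide_self inner_eq_zero_iff)
    then show ?thesis unfolding H by (simp only: scaleR_one) (simp add: h_def)
  qed (simp add: H h_def)
  then have "(s *\<^sub>R H) *v v = y"
    by (simp add: scaleR_matrix_vector_assoc[symmetric] matrix_vector_mult_scaleR)
  moreover have "transpose (s *\<^sub>R H) = s *\<^sub>R H"
    by (simp add: H_def transpose_def vec_eq_iff outer_def mat_def mult.commute)
  moreover have "spectral_norm (s *\<^sub>R H) \<le> norm y / norm v"
  proof -
    have "spectral_norm H \<le> 1"
      unfolding spectral_norm_def by (rule onorm_le) (simp add: isometry)
    moreover have "s \<ge> 0" by (simp add: s_def)
    ultimately have "s * spectral_norm H \<le> s" by (simp add: mult_left_le)
    with \<open>s \<ge> 0\<close> show ?thesis by (simp add: spectral_norm_scaleR flip: s_def)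
  qed
  ultimately show ?thesis using that by blast
qed

text \<open>The Frobenius norm dominates the spectral norm, so this rank-one matrix serves for both
  norms.\<close>

lemma frobenius_interpolation:
  fixes v y :: "real^'n"
  assumes "v \<noteq> 0"
  obtains B where "B *v v = y" "frobenius_norm B \<le> norm y / norm v"
proof
  show "((1 / (v \<bullet> v)) *\<^sub>R outer y v) *v v = y"
    using assms by (simp add: scaleR_matrix_vector_assoc[symmetric] outer_mult_vec)
  show "frobenius_norm ((1 / (v \<bullet> v)) *\<^sub>R outer y v) \<le> norm y / norm v"
    using assms by (simp add: frobenius_norm_eq norm_outer dot_square_norm power2_eq_square)
qed

text \<open>For orthogonal \<open>u\<close> and \<open>v\<close> the two summands are orthogonal
  matrices of equal norm, so Pythagoras yields the factor \<open>sqrt 2\<close>.\<close>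

lemma norm_symmetric_outer:
  assumes "u \<bullet> v = 0"
  shows "norm (outer u v + outer v u) = sqrt 2 * norm u * norm v"
proof -
  have "(norm (outer u v + outer v u))\<^sup>2 = 2 * (norm u * norm v)\<^sup>2"
    using assms
    by (simp add: dot_square_norm[symmetric] inner_add_left inner_add_right power_mult_distrib
        inner_outer outer_mult_vec inner_commute)
  also have "\<dots> = (sqrt 2 * norm u * norm v)\<^sup>2"
    by (simp add: power_mult_distrib)
  finally show ?thesis by (simp add: power2_eq_iff_nonneg)
qed

text \<open>The term \<open>outer v y\<close> that symmetrises the rank-one interpolant annihilates
  \<open>v\<close> because \<open>y\<close> is orthogonal to it; the price is the factor
  \<open>sqrt 2\<close>.\<close>

lemma symmetric_frobenius_interpolation:
  fixes v y :: "real^'n"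
  assumes "v \<noteq> 0" "y \<bullet> v = 0"
  obtains B where "transpose B = B" "B *v v = y" "frobenius_norm B \<le> sqrt 2 * (norm y / norm v)"
proof
  let ?B = "(1 / (v \<bullet> v)) *\<^sub>R (outer y v + outer v y)"
  show "transpose ?B = ?B"
    by (simp add: transpose_def vec_eq_iff outer_def mult.commute add.commute)
  show "?B *v v = y"
    using assms by (simp add: scaleR_matrix_vector_assoc[symmetric] matrix_vector_mult_add_rdistrib outer_mult_vec)
  show "frobenius_norm ?B \<le> sqrt 2 * (norm y / norm v)"
    using assms by (simp add: frobenius_norm_eq norm_symmetric_outer dot_square_norm power2_eq_square)
qed

text \<open>The component of \<open>B v\<close> orthogonal to \<open>v\<close> pairs with a symmetric \<open>B\<close> through both
  \<open>outer u v\<close> and \<open>outer v u\<close>, which is where the factor \<open>sqrt 2\<close> is gained.\<close>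

lemma norm_orthogonal_part_le:
  fixes v :: "real^'n"
  assumes sym: "transpose B = B" and v: "v \<noteq> 0"
  shows "sqrt 2 * norm (B *v v - ((v \<bullet> (B *v v)) / (v \<bullet> v)) *\<^sub>R v) \<le> frobenius_norm B * norm v"
    (is "sqrt 2 * norm ?u \<le> _")
proof (cases "?u = 0")
  case False
  have orth: "?u \<bullet> v = 0" using v by (simp add: inner_diff_left inner_commute[of "B *v v" v])
  have "?u \<bullet> ?u = ?u \<bullet> (B *v v)"
    using orth by (simp add: inner_diff_right[of ?u])
  moreover have "v \<bullet> (B *v ?u) = ?u \<bullet> (B *v v)"
    using dot_lmul_matrix[of v B ?u] sym by (metis inner_commute transpose_matrix_vector)
  ultimately have "2 * (?u \<bullet> ?u) = B \<bullet> (outer ?u v + outer v ?u)"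
    by (simp add: inner_add_right inner_outer)
  also have "\<dots> \<le> norm B * (sqrt 2 * norm ?u * norm v)"
    by (metis norm_cauchy_schwarz norm_symmetric_outer[OF orth])
  finally have "sqrt 2 * sqrt 2 * (norm ?u * norm ?u) \<le> norm B * (sqrt 2 * norm ?u * norm v)"
    by (simp add: dot_square_norm power2_eq_square)
  then have "(sqrt 2 * norm ?u) * (sqrt 2 * norm ?u) \<le> (sqrt 2 * norm ?u) * (norm B * norm v)"
    by (simp only: mult_ac)
  with False show ?thesis
    by (simp add: frobenius_norm_eq mult_le_cancel_left)
qed (simp add: frobenius_norm_eq)

text \<open>Each multiple uses its full weight with the sign of \<open>c i\<close>, so no
  cancellation occurs and the coefficients of \<open>B\<close> add up to 1.\<close>

lemma sum_attains:
  fixes c w :: "'m::finite \<Rightarrow> real" and N :: "real^'n^'n \<Rightarrow> real"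
  assumes w: "\<And>i. w i \<ge> 0" and r: "r = (\<Sum>i\<in>UNIV. \<bar>c i\<bar> * w i)"
    and B: "N B \<le> r" and N: "\<And>k B. N (k *\<^sub>R B) = \<bar>k\<bar> * N B" and Nv: "norm (B *v v) \<le> N B * norm v"
  obtains t where "\<And>i. N (t i *\<^sub>R B) \<le> w i" "(\<Sum>i\<in>UNIV. c i *\<^sub>R (t i *\<^sub>R B)) *v v = B *v v"
proof (cases "r = 0")
  case True
  have "norm (B *v v) \<le> 0"
    using order_trans[OF Nv mult_right_mono[OF B]] True by simp
  then show ?thesis using that[of "\<lambda>_. 0"] w N[of 0 B] by simp
next
  case False
  have "r \<ge> 0" unfolding r by (intro sum_nonneg) (simp add: w)
  with False have r0: "r > 0" by simp
  let ?t = "\<lambda>i. sgn (c i) * w i / r"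
  show ?thesis
  proof (rule that[of ?t])
    fix i
    have "\<bar>?t i\<bar> * N B \<le> \<bar>?t i\<bar> * r" using B by (intro mult_left_mono) auto
    also have "\<dots> \<le> w i" using r0 w[of i] by (simp add: abs_mult abs_sgn_eq)
    finally show "N (?t i *\<^sub>R B) \<le> w i" by (simp add: N)
  next
    have "(\<Sum>i\<in>UNIV. c i *\<^sub>R (?t i *\<^sub>R B)) = ((\<Sum>i\<in>UNIV. c i * sgn (c i) * w i) / r) *\<^sub>R B"
      by (simp add: scaleR_sum_left sum_divide_distrib mult.assoc)
    also have "(\<Sum>i\<in>UNIV. c i * sgn (c i) * w i) = r"
      by (simp add: r abs_sgn)
    finally show "(\<Sum>i\<in>UNIV. c i *\<^sub>R (?t i *\<^sub>R B)) *v v = B *v v" using r0 by simp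
  qed
qed

section \<open>Condition numbers\<close>

text \<open>The derivative of the eigenvector depends on the perturbation only through these
  vectors. The norm \<open>N\<close> and the structure \<open>P\<close> are parameters so that all
  the condition numbers are treated alike.\<close>

definition reachable ::
    "('m::finite \<Rightarrow> real^'n \<Rightarrow> real) \<Rightarrow> ('m \<Rightarrow> real) \<Rightarrow> real^'n \<Rightarrow> (real^'n^'n \<Rightarrow> real) \<Rightarrow>
      (real^'n^'n \<Rightarrow> bool) \<Rightarrow> (real^'n) set" where
  "reachable f w v N P = {mat_comb f E v *v v | E. \<forall>i. N (E i) \<le> w i \<and> P (E i)}"

definition weight_sum :: "('m::finite \<Rightarrow> real^'n \<Rightarrow> real) \<Rightarrow> ('m \<Rightarrow> real) \<Rightarrow> real^'n \<Rightarrow> real" where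
  "weight_sum f w v = (\<Sum>i\<in>UNIV. \<bar>f i v\<bar> * w i)"

section \<open>Linearisation at a simple eigenpair\<close>

lemma jac_has_derivative:
  assumes "((\<lambda>x. M x *v x) has_derivative F') (at v)"
  shows "F' = (\<lambda>h. jac M v *v h)"
proof -
  have "(\<lambda>x. M x *v x) differentiable (at v)" using assms by (auto simp: differentiable_def)
  then show ?thesis
    unfolding jac_def using assms has_derivative_unique jacobian_works by blast
qed

text \<open>A nonzero \<open>h\<close> orthogonal to \<open>v\<close> would be a second eigenvector
  (if \<open>m = 0\<close>) or the next member of a Jordan chain (otherwise), and either makes the
  root at least double.\<close>

lemma simple_eigenpair_nondegenerate:
  assumes simple: "simple_eigenpair M l v"
    and h: "jac M v *v h = l *\<^sub>R h + m *\<^sub>R v" "v \<bullet> h = 0"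
  shows "h = 0 \<and> m = 0"
proof -
  have v: "v \<noteq> 0" "jac M v *v v = l *\<^sub>R v" "order l (charpoly (jac M v)) = 1"
    using simple by (auto simp: simple_eigenpair_def eigenpair_def)
  have "h = 0"
  proof (rule ccontr)
    assume "h \<noteq> 0"
    then have "h \<noteq> c *\<^sub>R v" for c using h(2) by auto
    with order_charpoly_ge_2[OF v(2,1) h(1)] v(3) show False by simp
  qed
  with h(1) v(1) show ?thesis by simp
qed

text \<open>\<open>X v = 0\<close> because a perturbation along \<open>v\<close> is absorbed by the eigenvalue.\<close>

lemma eigvec_deriv_linear:
  fixes f :: "'m::finite \<Rightarrow> real^'n \<Rightarrow> real"
  assumes C1: "\<And>i. continuously_differentiable_on (f i) (UNIV - {0})"
    and simple: "simple_eigenpair (mat_comb f A) l v" and v2: "1/2 * (v \<bullet> v) = 1"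
  obtains X where "linear X" "X v = 0"
    "\<And>E d. eigvec_deriv f A E l v d \<longleftrightarrow> d = X (mat_comb f E v *v v)"
proof -
  let ?J = "jac (mat_comb f A) v"
  have v: "v \<noteq> 0" and eig: "mat_comb f A v *v v = l *\<^sub>R v"
    using simple by (auto simp: simple_eigenpair_def eigenpair_def)
  obtain F' where F': "\<And>x. x \<in> UNIV - {0} \<Longrightarrow>
      ((\<lambda>x. mat_comb f A x *v x) has_derivative blinfun_apply (F' x)) (at x)"
    "continuous_on (UNIV - {0}) F'"
    by (rule mat_comb_C1[where f = f and A = A, OF C1]) (rule that; blast)
  have J: "blinfun_apply (F' v) = (\<lambda>h. ?J *v h)"
    using F'(1) v by (intro jac_has_derivative) simp
  \<comment> \<open>The linearised system bordered by the normalisation. Only the uniqueness of its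
    solution is needed to define \<open>X\<close>, so a left inverse of \<open>T\<close>
    suffices.\<close>
  define T where "T p = (?J *v fst p - l *\<^sub>R fst p - snd p *\<^sub>R v, v \<bullet> fst p)" for p :: "(real^'n) \<times> real"
  have lin: "linear T"
    by (rule linearI) (simp_all add: T_def algebra_simps matrix_vector_right_distrib
        matrix_vector_mult_scaleR)
  have "inj T"
    unfolding linear_injective_0[OF lin]
  proof (intro allI impI)
    fix p assume "T p = 0"
    then have "?J *v fst p = l *\<^sub>R fst p + snd p *\<^sub>R v" "v \<bullet> fst p = 0"
      by (auto simp: T_def zero_prod_def algebra_simps)
    from simple_eigenpair_nondegenerate[OF simple this] show "p = 0"
      by (simp add: prod_eq_iff)
  qed
  then obtain T' where T': "linear T'" "\<And>p. T' (T p) = p"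
    using linear_injective_left_inverse[OF lin] by (metis comp_apply id_apply)
  define X where "X y = fst (T' (- y, 0))" for y
  have linX: "linear X"
  proof (rule linearI)
    show "X (x + y) = X x + X y" for x y
      using linear_add[OF T'(1), of "(- x, 0)" "(- y, 0)"] by (simp add: X_def)
    show "X (c *\<^sub>R x) = c *\<^sub>R X x" for c x
      using linear_scale[OF T'(1), of c "(- x, 0)"] by (simp add: X_def)
  qed
  have X: "X y = d" if "?J *v d + y = l *\<^sub>R d + m *\<^sub>R v" "v \<bullet> d = 0" for y d m
  proof -
    have "T (d, m) = (- y, 0)" using that by (simp add: T_def algebra_simps)
    then show ?thesis using T'(2)[of "(d, m)"] by (simp add: X_def)
  qed
  \<comment> \<open>The direction \<open>v\<close> is matched by \<open>d = 0\<close> together with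
    eigenvalue derivative 1.\<close>
  have Xv: "X v = 0" using X[of 0 v 1] by simp
  have perturbed: "(mat_comb f A x + \<epsilon> *\<^sub>R (\<Sum>i\<in>UNIV. f i x *\<^sub>R E i)) *v x =
      mat_comb f A x *v x + \<epsilon> *\<^sub>R (mat_comb f E x *v x)" for E \<epsilon> x
    by (simp add: mat_comb_def matrix_vector_mult_add_rdistrib scaleR_matrix_vector_assoc)
  have unique: "d = X (mat_comb f E v *v v)" if deriv: "eigvec_deriv f A E l v d" for E d
  proof -
    obtain K' where K': "\<And>x. x \<in> UNIV - {0} \<Longrightarrow>
        ((\<lambda>x. mat_comb f E x *v x) has_derivative blinfun_apply (K' x)) (at x)"
      by (rule mat_comb_C1[where f = f and A = E, OF C1]) (rule that; blast)
    from deriv obtain U L V where U: "open U" "0 \<in> U" "L differentiable_on U"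
      and V: "(V has_vector_derivative d) (at 0)" "V 0 = v" "L 0 = l"
      and eq: "\<And>\<epsilon>. \<epsilon> \<in> U \<Longrightarrow> mat_comb f A (V \<epsilon>) *v V \<epsilon> + \<epsilon> *\<^sub>R (mat_comb f E (V \<epsilon>) *v V \<epsilon>) = L \<epsilon> *\<^sub>R V \<epsilon>"
      and nrm: "\<And>\<epsilon>. \<epsilon> \<in> U \<Longrightarrow> V \<epsilon> \<bullet> V \<epsilon> = v \<bullet> v"
      unfolding eigvec_deriv_def perturbed using v2 by auto
    obtain m where "F' v d + mat_comb f E v *v v = l *\<^sub>R d + m *\<^sub>R v" "v \<bullet> d = 0"
      using eigenvector_branch_derivative[OF U V F'(1) K'(1) eq nrm] v by blast
    then show ?thesis using X by (simp add: J)
  qed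
  have "\<exists>d. eigvec_deriv f A E l v d" for E
  proof -
    obtain K' where K': "\<And>x. x \<in> UNIV - {0} \<Longrightarrow>
        ((\<lambda>x. mat_comb f E x *v x) has_derivative blinfun_apply (K' x)) (at x)"
      "continuous_on (UNIV - {0}) K'"
      by (rule mat_comb_C1[where f = f and A = E, OF C1]) (rule that; blast)
    have nondeg: "h = 0 \<and> m = 0" if "blinfun_apply (F' v) h = l *\<^sub>R h + m *\<^sub>R v" "v \<bullet> h = 0" for h m
      using that simple_eigenpair_nondegenerate[OF simple, of h m] by (simp add: J)
    have S: "open (UNIV - {0 :: real^'n})" "v \<in> UNIV - {0}" using v by (auto intro: open_delete)
    obtain U L V where U: "open U" "0 \<in> U" "L differentiable_on U" "V differentiable_on U"
      "L 0 = l" "V 0 = v"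
      and eq: "\<And>\<epsilon>. \<epsilon> \<in> U \<Longrightarrow> mat_comb f A (V \<epsilon>) *v V \<epsilon> + \<epsilon> *\<^sub>R (mat_comb f E (V \<epsilon>) *v V \<epsilon>) = L \<epsilon> *\<^sub>R V \<epsilon>"
      and nrm: "\<And>\<epsilon>. \<epsilon> \<in> U \<Longrightarrow> V \<epsilon> \<bullet> V \<epsilon> = v \<bullet> v"
      using eigenvector_branch[OF S F' K' eig nondeg] by blast
    have "V differentiable (at 0)"
      using U by (simp add: differentiable_on_eq_differentiable_at)
    then obtain d where "(V has_vector_derivative d) (at 0)"
      using vector_derivative_works by blast
    then show ?thesis
      unfolding eigvec_deriv_def perturbed using U eq nrm v2 by metis
  qed
  \<comment> \<open>Existence gives the converse implication: the derivative that exists must equal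
    \<open>X\<close> of the perturbation vector.\<close>
  with unique linX Xv that show ?thesis by metis
qed

section \<open>Attainable perturbation vectors\<close>

text \<open>The map \<open>q\<close> is the identity for the full balls and the orthogonal
  projection away from \<open>v\<close> in the symmetric Frobenius case.\<close>

lemma reachable_bound:
  assumes "y \<in> reachable f w v N P"
    and q: "linear q" "\<And>B. P B \<Longrightarrow> norm (q (B *v v)) \<le> k * N B" "0 \<le> k"
  shows "norm (q y) \<le> k * weight_sum f w v"
proof -
  obtain E where E: "\<And>i. N (E i) \<le> w i" "\<And>i. P (E i)" and y: "y = mat_comb f E v *v v"
    using assms(1) by (auto simp: reachable_def)
  have "norm (q y) = norm (\<Sum>i\<in>UNIV. f i v *\<^sub>R q (E i *v v))"
    by (simp add: y mat_comb_mult_vec linear_sum[OF q(1)] linear_scale[OF q(1)])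
  also have "\<dots> \<le> (\<Sum>i\<in>UNIV. k * (\<bar>f i v\<bar> * w i))"
  proof (rule sum_norm_le)
    fix i
    have "norm (q (E i *v v)) \<le> k * w i"
      using q(2)[OF E(2)] E(1) q(3) by (meson mult_left_mono order_trans)
    then have "\<bar>f i v\<bar> * norm (q (E i *v v)) \<le> \<bar>f i v\<bar> * (k * w i)"
      by (intro mult_left_mono) auto
    then show "norm (f i v *\<^sub>R q (E i *v v)) \<le> k * (\<bar>f i v\<bar> * w i)"
      by (simp add: mult_ac)
  qed
  finally show ?thesis by (simp add: weight_sum_def sum_distrib_left)
qed

text \<open>Reduces a whole family \<open>E\<close> to one interpolating matrix \<open>B\<close>,
  which is distributed over the indices by scaling.\<close>

lemma reachableI:
  assumes w: "\<And>i. w i \<ge> 0" and N: "\<And>k B. N (k *\<^sub>R B) = \<bar>k\<bar> * N B"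
    and Nv: "\<And>B. norm (B *v v) \<le> N B * norm v"
    and P: "\<And>k B. P B \<Longrightarrow> P (k *\<^sub>R B)"
    and B: "P B" "B *v v = y" "N B \<le> weight_sum f w v"
  shows "y \<in> reachable f w v N P"
proof -
  obtain t where t: "\<And>i. N (t i *\<^sub>R B) \<le> w i"
    "(\<Sum>i\<in>UNIV. f i v *\<^sub>R (t i *\<^sub>R B)) *v v = B *v v"
    using sum_attains[where c = "\<lambda>i. f i v" and N = N and v = v, OF w weight_sum_def B(3) N Nv] by blast
  then show ?thesis
    unfolding reachable_def mem_Collect_eq using B P
    by (intro exI[of _ "\<lambda>i. t i *\<^sub>R B"]) (simp add: mat_comb_def)
qed

lemma frobenius_norm_scaleR: "frobenius_norm (k *\<^sub>R B) = \<bar>k\<bar> * frobenius_norm B"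
  by (simp add: frobenius_norm_eq)

lemma reachable_eq_cball:
  fixes v :: "real^'n"
  assumes w: "\<And>i. w i \<ge> 0" and v: "v \<noteq> 0"
    and N: "\<And>k B. N (k *\<^sub>R B) = \<bar>k\<bar> * N B" and Nv: "\<And>B. norm (B *v v) \<le> N B * norm v"
    and P: "\<And>k B. P B \<Longrightarrow> P (k *\<^sub>R B)"
    and interp: "\<And>y. \<exists>B. P B \<and> B *v v = y \<and> N B \<le> norm y / norm v"
  shows "reachable f w v N P = cball 0 (weight_sum f w v * norm v)"
proof (intro set_eqI iffI)
  fix y assume "y \<in> reachable f w v N P"
  from reachable_bound[OF this linear_id, of "norm v"] Nv
  show "y \<in> cball 0 (weight_sum f w v * norm v)" by (simp add: mult.commute)
next
  fix y :: "real^'n" assume y: "y \<in> cball 0 (weight_sum f w v * norm v)"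
  obtain B where B: "P B" "B *v v = y" "N B \<le> norm y / norm v" using interp by blast
  have "norm y / norm v \<le> weight_sum f w v" using y v by (simp add: divide_le_eq)
  with B(3) have "N B \<le> weight_sum f w v" by linarith
  with reachableI[where w = w and N = N and P = P, OF w N Nv P B(1,2)] show "y \<in> reachable f w v N P" by blast
qed

lemma reachable_general:
  assumes "\<And>i. w i \<ge> 0" "v \<noteq> 0" "N = spectral_norm \<or> N = frobenius_norm"
  shows "reachable f w v N (\<lambda>_. True) = cball 0 (weight_sum f w v * norm v)"
proof (rule reachable_eq_cball[OF assms(1,2)])
  show "N (k *\<^sub>R B) = \<bar>k\<bar> * N B" for k B
    using assms(3) spectral_norm_scaleR frobenius_norm_scaleR by metis
  show "norm (B *v v) \<le> N B * norm v" for B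
    using assms(3) norm_mult_vec_le_spectral norm_mult_vec_le_frobenius frobenius_norm_eq by metis
  fix y
  obtain B where B: "B *v v = y" "frobenius_norm B \<le> norm y / norm v"
    by (rule frobenius_interpolation[OF assms(2)])
  with spectral_le_frobenius[of B] show "\<exists>B. True \<and> B *v v = y \<and> N B \<le> norm y / norm v"
    using assms(3) by (intro exI[of _ B]) auto
qed auto

lemma reachable_symmetric_spectral:
  assumes "\<And>i. w i \<ge> 0" "v \<noteq> 0"
  shows "reachable f w v spectral_norm (\<lambda>B. B = transpose B) = cball 0 (weight_sum f w v * norm v)"
proof (rule reachable_eq_cball[OF assms spectral_norm_scaleR norm_mult_vec_le_spectral])
  show "k *\<^sub>R B = transpose (k *\<^sub>R B)" if "B = transpose B" for k and B :: "real^'n^'n"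
    using that by (simp add: transpose_scaleR)
  show "\<exists>B. B = transpose B \<and> B *v v = y \<and> spectral_norm B \<le> norm y / norm v" for y
    using symmetric_spectral_interpolation[OF assms(2)] by metis
qed

text \<open>The reachable set is in general no ball, since along \<open>v\<close> no factor
  \<open>sqrt 2\<close> is lost. Only the images under \<open>X\<close>, which ignores that
  direction, are compared.\<close>

lemma reachable_symmetric_frobenius:
  fixes v :: "real^'n"
  assumes w: "\<And>i. w i \<ge> 0" and v: "v \<noteq> 0" and X: "linear X" "X v = 0"
  shows "X ` reachable f w v frobenius_norm (\<lambda>B. B = transpose B) =
    X ` cball 0 (weight_sum f w v * norm v / sqrt 2)"
proof -
  let ?R = "reachable f w v frobenius_norm (\<lambda>B. B = transpose B)"
  define P where "P y = y - ((v \<bullet> y) / (v \<bullet> v)) *\<^sub>R v" for y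
  have P: "linear P"
    by (rule linearI) (simp_all add: P_def inner_add_right algebra_simps add_divide_distrib)
  have XP: "X (P y) = X y" for y
    by (simp add: P_def linear_diff[OF X(1)] linear_scale[OF X(1)] X(2))
  have Pv: "P y \<bullet> v = 0" for y
    using v by (simp add: P_def inner_diff_left inner_commute[of y v])
  have contract: "norm (P y) \<le> norm y" for y
  proof -
    have "y \<bullet> P y = P y \<bullet> P y"
      using Pv[of y] by (simp add: P_def[of y] inner_diff_left inner_diff_right inner_commute)
    then have "norm (P y) * norm (P y) \<le> norm y * norm (P y)"
      by (metis norm_cauchy_schwarz dot_square_norm power2_eq_square)
    then show ?thesis by (cases "P y = 0") auto
  qed
  have "P y \<in> cball 0 (weight_sum f w v * norm v / sqrt 2)" if "y \<in> ?R" for y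
  proof -
    have "norm (P (B *v v)) \<le> (norm v / sqrt 2) * frobenius_norm B" if "B = transpose B" for B
      using norm_orthogonal_part_le[of B v] that v by (simp add: P_def field_simps)
    from reachable_bound[OF \<open>y \<in> ?R\<close> P this] show ?thesis by (simp add: mult.commute)
  qed
  moreover have "P y \<in> ?R" if y: "y \<in> cball 0 (weight_sum f w v * norm v / sqrt 2)" for y
  proof -
    obtain B where B: "transpose B = B" "B *v v = P y"
      "frobenius_norm B \<le> sqrt 2 * (norm (P y) / norm v)"
      by (rule symmetric_frobenius_interpolation[OF v Pv])
    have "norm (P y) \<le> weight_sum f w v * norm v / sqrt 2"
      using contract[of y] y by simp
    then have "sqrt 2 * (norm (P y) / norm v) \<le> weight_sum f w v"
      using v by (simp add: field_simps)
    with B(3) have "frobenius_norm B \<le> weight_sum f w v" by linarith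
    then show ?thesis
      using B(1,2) by (intro reachableI[OF w frobenius_norm_scaleR])
        (auto simp: transpose_scaleR frobenius_norm_eq norm_mult_vec_le_frobenius)
  qed
  \<comment> \<open>As \<open>X\<close> agrees with \<open>X\<close> after \<open>P\<close>, it is
    enough that \<open>P\<close> maps each of the two sets into the other.\<close>
  ultimately show ?thesis
    unfolding image_def using XP by (intro Collect_cong) metis
qed

section \<open>Comparison of the suprema\<close>

lemma Sup_linear_image_cball:
  fixes X :: "'a::real_normed_vector \<Rightarrow> 'b::real_normed_vector"
  assumes X: "linear X" and c: "c > 0" and \<rho>: "\<rho> \<ge> 0"
  shows "(SUP d\<in>X ` cball 0 (c * \<rho>). ereal (norm d / k)) =
    ereal c * (SUP d\<in>X ` cball 0 \<rho>. ereal (norm d / k))"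
proof -
  have "cball 0 (c * \<rho>) = (\<lambda>y. c *\<^sub>R y) ` cball (0 :: 'a) \<rho>"
    using cball_scale[of c "0 :: 'a" \<rho>] c by simp
  then have "(SUP d\<in>X ` cball 0 (c * \<rho>). ereal (norm d / k)) =
      (SUP y\<in>cball 0 \<rho>. ereal c * ereal (norm (X y) / k))"
    using c by (simp add: image_image linear_scale[OF X])
  also have "\<dots> = ereal c * (SUP y\<in>cball 0 \<rho>. ereal (norm (X y) / k))"
    \<comment> \<open>The hypothesis \<open>\<rho> \<ge> 0\<close> keeps the ball nonempty, so that
      the factor can be moved out of the supremum.\<close>
    using c \<rho> by (intro Sup_ereal_mult_left'[symmetric]) auto
  finally show ?thesis by (simp add: image_image)
qed

theorem theorem3p10:
  fixes f :: "'m::finite \<Rightarrow> real^'n \<Rightarrow> real"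
    and A :: "'m \<Rightarrow> real^'n^'n"
    and w :: "'m \<Rightarrow> real"
    and l :: real
    and v :: "real^'n"
    and N :: "real^'n^'n \<Rightarrow> real"
  assumes "\<And>i. transpose (A i) = A i"
    and "\<And>i. scaling_invariant (f i)"
    and "\<And>i. continuously_differentiable_on (f i) (UNIV - {0})"
    and "simple_eigenpair (mat_comb f A) l v"
    and "1/2 * (v \<bullet> v) = 1"
    and "\<And>i. w i \<ge> 0"
    and "N = spectral_norm \<or> N = frobenius_norm"
  shows "kappa_sym spectral_norm w f A l v = kappa N w f A l v \<and>
         kappa_sym frobenius_norm w f A l v = ereal (1 / sqrt 2) * kappa N w f A l v"
proof -
  have v: "v \<noteq> 0" using assms(5) by auto
  obtain X where X: "linear X" "X v = 0"
    and deriv: "\<And>E d. eigvec_deriv f A E l v d \<longleftrightarrow> d = X (mat_comb f E v *v v)"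
    using eigvec_deriv_linear[OF assms(3,4,5)] by blast
  have kappa: "kappa N w f A l v = (SUP d\<in>X ` reachable f w v N (\<lambda>_. True). ereal (norm d / norm v))"
    unfolding kappa_def deriv reachable_def by (intro arg_cong[where f = Sup]) blast
  have kappa_sym: "kappa_sym M w f A l v =
      (SUP d\<in>X ` reachable f w v M (\<lambda>B. B = transpose B). ereal (norm d / norm v))" for M
    unfolding kappa_sym_def deriv reachable_def by (intro arg_cong[where f = Sup]) blast
  have "weight_sum f w v \<ge> 0"
    unfolding weight_sum_def by (intro sum_nonneg) (simp add: assms(6))
  then have "weight_sum f w v * norm v \<ge> 0" by simp
  \<comment> \<open>The balls for the general and the symmetric Frobenius case differ only by the
    factor \<open>1 / sqrt 2\<close> in the radius.\<close>
  from Sup_linear_image_cball[OF X(1) _ this, of "1 / sqrt 2" "norm v"]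
  show ?thesis
    unfolding kappa kappa_sym reachable_general[OF assms(6) v assms(7)]
      reachable_symmetric_spectral[OF assms(6) v] reachable_symmetric_frobenius[OF assms(6) v X]
    by simp
qed

end
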